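(* Let $a>1$ be a fixed real number. For any finite set of integers $S$ and any integer $n\ge 0$, $$r(\mathcal{A}_n^S)=\sum_{k=0}^{n}\binom{n}{k}\,r(\mathcal{C}_k^S)\,r(\mathcal{C}_{n-k}^S).$$
   Context: For a finite set $S$ of integers, $\mathcal{A}_n^S$ is the hyperplane arrangement in $\mathbb{R}^n$ given by $\{x_i=0\mid i\in[n]\}\cup\{x_i=a^kx_j\mid k\in S,\ 1\le i<j\le n\}$, and $\mathcal{C}_n^S$ is the arrangement in $\mathbb{R}^n$ given by $\{x_i-x_j=k\mid k\in S,\ 1\le i<j\le n\}$, where $[n]=\{1,\dots,n\}$. For an arrangement $\mathcal{A}$ in $\mathbb{R}^n$, $r(\mathcal{A})$ denotes the number of regions, i.e. connected components of the complement in $\mathbb{R}^n$ of the union of the hyperplanes. In $\mathbb{R}^0$ (a point) the arrangements are empty, so $r(\mathcal{A}_0^S)=r(\mathcal{C}_0^S)=1$. *)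

theory Defs
  imports "HOL-Analysis.Analysis"
begin

(* R^n is the library topology Euclidean_space n: functions x :: nat => real with x i = 0 for
   i >= n.  The paper's coordinate x_i (1 <= i <= n) is therefore "x (i - 1)". *)

definition arrangement_complement :: "nat \<Rightarrow> (nat \<Rightarrow> real) set set \<Rightarrow> (nat \<Rightarrow> real) set" where
  "arrangement_complement n \<A> = topspace (Euclidean_space n) - \<Union>\<A>"

definition regions :: "nat \<Rightarrow> (nat \<Rightarrow> real) set set \<Rightarrow> (nat \<Rightarrow> real) set set" where
  "regions n \<A> =
     connected_components_of (subtopology (Euclidean_space n) (arrangement_complement n \<A>))"

(* card is 0 on infinite sets; this is harmless because a finite arrangement of hyperplanes has
   only finitely many regions. *)
definition num_regions :: "nat \<Rightarrow> (nat \<Rightarrow> real) set set \<Rightarrow> nat" where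
  "num_regions n \<A> = card (regions n \<A>)"

definition mult_arrangement :: "real \<Rightarrow> int set \<Rightarrow> nat \<Rightarrow> (nat \<Rightarrow> real) set set" where
  "mult_arrangement a S n =
     {{x \<in> topspace (Euclidean_space n). x i = 0} | i. i < n} \<union>
     {{x \<in> topspace (Euclidean_space n). x i = a powi k * x j} | i j k. k \<in> S \<and> i < j \<and> j < n}"

definition add_arrangement :: "int set \<Rightarrow> nat \<Rightarrow> (nat \<Rightarrow> real) set set" where
  "add_arrangement S n =
     {{x \<in> topspace (Euclidean_space n). x i - x j = of_int k} | i j k. k \<in> S \<and> i < j \<and> j < n}"

end

theory Submission
  imports Defs
begin

text \<open>
  Regions are counted through sign patterns. The points of the complement at which every defining
  affine form has a prescribed sign make up a convex open set; these sets partition the complement,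
  so they are its connected components, and the number of regions is the number of sign patterns
  that occur (\<open>num_regions_eq_card_sign_patterns\<close>).

  For the multiplicative arrangement, let \<open>P\<close> be the set of indices of the positive coordinates of a
  point \<open>x\<close> off the coordinate hyperplanes, and put \<open>y i = log a \<bar>x i\<bar>\<close>. If \<open>x i\<close> and \<open>x j\<close> have
  opposite signs, the sign of \<open>x i - a powi k * x j\<close> is that of \<open>x i\<close> and carries no new
  information. If both are positive, it is the sign of \<open>y i - y j - k\<close>; if both are negative, it is
  the opposite sign. Hence the sign pattern of \<open>x\<close> amounts to \<open>P\<close> together with two sign patterns of
  the additive arrangement, one for the coordinates in \<open>P\<close> and one for the others. The two blocks of
  coordinates can be chosen independently, so all such triples occur
  (\<open>num_regions_mult_arrangement\<close>).

  The additive arrangement depends only on the order of the indices, so on an index set with \<open>k\<close>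
  elements it has as many patterns as on the first \<open>k\<close> naturals (\<open>card_difference_patterns\<close>).
  Summing over \<open>P\<close> and grouping by cardinality gives the binomial convolution.
\<close>

section \<open>Regions as sign patterns\<close>

text \<open>
  Each fibre is closed as well as open, since its complement is the union of the other fibres. A
  connected component therefore lies inside one fibre, and being maximal it contains that fibre.
\<close>
lemma connected_components_of_open_fibres:
  assumes opn: "\<And>s. openin X {x \<in> topspace X. \<sigma> x = s}"
    and conn: "\<And>s. connectedin X {x \<in> topspace X. \<sigma> x = s}"
  shows "connected_components_of X = (\<lambda>s. {x \<in> topspace X. \<sigma> x = s}) ` \<sigma> ` topspace X"
proof -
  have comp: "connected_component_of_set X x = {y \<in> topspace X. \<sigma> y = \<sigma> x}"
    if x: "x \<in> topspace X" for x
  proof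
    have "topspace X - {y \<in> topspace X. \<sigma> y = \<sigma> x}
        = \<Union>((\<lambda>s. {y \<in> topspace X. \<sigma> y = s}) ` (UNIV - {\<sigma> x}))"
      by auto
    moreover have "openin X (\<Union>((\<lambda>s. {y \<in> topspace X. \<sigma> y = s}) ` (UNIV - {\<sigma> x})))"
      using opn by blast
    ultimately have "closedin X {y \<in> topspace X. \<sigma> y = \<sigma> x}"
      by (simp add: closedin_def)
    moreover have "x \<in> connected_component_of_set X x"
      using x by (simp add: connected_component_of_refl)
    ultimately show "connected_component_of_set X x \<subseteq> {y \<in> topspace X. \<sigma> y = \<sigma> x}"
      using connectedin_clopen_cases[OF connectedin_connected_component_of[of X x] _ opn[of "\<sigma> x"]] x
      by (auto simp: disjnt_iff)
    show "{y \<in> topspace X. \<sigma> y = \<sigma> x} \<subseteq> connected_component_of_set X x"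
      by (rule connected_component_of_maximal[OF conn]) (use x in simp)
  qed
  show ?thesis
    unfolding connected_components_of_def image_image using comp by (rule image_cong[OF refl])
qed

text \<open>
  The second hypothesis is convexity, written coordinatewise; a line segment between two points is a
  path, because each of its coordinates is continuous in \<open>t\<close>.
\<close>
lemma connectedin_Euclidean_space_convex:
  assumes sub: "F \<subseteq> topspace (Euclidean_space n)"
    and convex: "\<And>x y t. \<lbrakk>x \<in> F; y \<in> F; 0 \<le> t; t \<le> (1::real)\<rbrakk> \<Longrightarrow> (\<lambda>i. (1 - t) * x i + t * y i) \<in> F"
  shows "connectedin (Euclidean_space n) F"
proof (rule path_connectedin_imp_connectedin)
  show "path_connectedin (Euclidean_space n) F"
    unfolding path_connectedin_def path_connected_space_def
  proof (intro conjI sub ballI)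
    fix x y assume "x \<in> topspace (subtopology (Euclidean_space n) F)"
      and "y \<in> topspace (subtopology (Euclidean_space n) F)"
    then have xy: "x \<in> F" "y \<in> F" by auto
    let ?g = "\<lambda>t i. (1 - t) * x i + t * y i"
    have "continuous_map (top_of_set {0..1}) (powertop_real UNIV) ?g"
      by (auto simp: continuous_map_componentwise_UNIV intro!: continuous_intros)
    then have "pathin (subtopology (Euclidean_space n) F) ?g"
      using sub convex xy sub[THEN subsetD, OF convex[OF xy]]
      by (auto simp: pathin_def Euclidean_space_def continuous_map_in_subtopology image_subset_iff Pi_iff)
    moreover have "?g 0 = x" "?g 1 = y" by auto
    ultimately show "\<exists>g. pathin (subtopology (Euclidean_space n) F) g \<and> g 0 = x \<and> g 1 = y"
      by blast
  qed
qed

text \<open>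
  The forms are indexed by an arbitrary set \<open>H\<close> rather than by the hyperplanes themselves. Different
  indices may thus describe the same hyperplane, or an empty one, without changing the count.
\<close>
lemma num_regions_eq_card_sign_patterns:
  fixes f :: "'h \<Rightarrow> (nat \<Rightarrow> real) \<Rightarrow> real"
  assumes fin: "finite H"
    and cont: "\<And>h. h \<in> H \<Longrightarrow> continuous_map (Euclidean_space n) euclideanreal (f h)"
    and aff: "\<And>h x y t. h \<in> H \<Longrightarrow> f h (\<lambda>i. (1 - t) * x i + t * y i) = (1 - t) * f h x + t * f h y"
  shows "num_regions n ((\<lambda>h. {x \<in> topspace (Euclidean_space n). f h x = 0}) ` H) =
    card ((\<lambda>x. {h \<in> H. f h x > 0}) ` {x \<in> topspace (Euclidean_space n). \<forall>h\<in>H. f h x \<noteq> 0})"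
proof -
  let ?E = "Euclidean_space n"
  let ?C = "{x \<in> topspace ?E. \<forall>h\<in>H. f h x \<noteq> 0}"
  let ?X = "subtopology ?E ?C"
  let ?\<sigma> = "\<lambda>x. {h \<in> H. f h x > 0}"
  have compl: "arrangement_complement n ((\<lambda>h. {x \<in> topspace ?E. f h x = 0}) ` H) = ?C"
    by (auto simp: arrangement_complement_def)
  have top: "topspace ?X = ?C" by auto
  \<comment> \<open>A pattern that contains something outside \<open>H\<close> never occurs, and its fibre is empty.\<close>
  let ?half = "\<lambda>T h. {x \<in> topspace ?E. f h x \<noteq> 0 \<and> (f h x > 0 \<longleftrightarrow> h \<in> T)}"
  have fibre: "{x \<in> ?C. ?\<sigma> x = T} = (if T \<subseteq> H then topspace ?E \<inter> (\<Inter>h\<in>H. ?half T h) else {})"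
    for T
    by (cases "T \<subseteq> H") (simp_all, blast+)
  have half: "openin ?E (?half T h)" if "h \<in> H" for h T
  proof -
    have "?half T h = {x \<in> topspace ?E. f h x \<in> (if h \<in> T then {0<..} else {..<0})}"
      by (auto simp: less_le not_less)
    then show ?thesis
      using openin_continuous_map_preimage[OF cont[OF that], of "if h \<in> T then {0<..} else {..<0}"]
      by (simp split: if_splits)
  qed
  have opn: "openin ?X {x \<in> topspace ?X. ?\<sigma> x = T}" for T
  proof -
    have "openin ?E {x \<in> ?C. ?\<sigma> x = T}"
      unfolding fibre using fin half by (auto intro!: openin_Int_Inter)
    then show ?thesis
      unfolding top openin_subtopology by (intro exI[of _ "{x \<in> ?C. ?\<sigma> x = T}"]) auto
  qed
  have conn: "connectedin ?X {x \<in> topspace ?X. ?\<sigma> x = T}" for T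
  proof -
    have same_side: "(1 - t) * p + t * q \<noteq> 0 \<and> ((1 - t) * p + t * q > 0 \<longleftrightarrow> b)"
      if "p \<noteq> 0 \<and> (p > 0 \<longleftrightarrow> b)" "q \<noteq> 0 \<and> (q > 0 \<longleftrightarrow> b)" "0 \<le> t" "t \<le> 1" for p q t :: real and b
      using that convex_bound_lt[of p 0 q "1 - t" t] convex_bound_lt[of "-p" 0 "-q" "1 - t" t]
      by (cases b) (auto simp: less_le)
    have "connectedin ?E {x \<in> ?C. ?\<sigma> x = T}"
    proof (rule connectedin_Euclidean_space_convex)
      show "{x \<in> ?C. ?\<sigma> x = T} \<subseteq> topspace ?E" by auto
    next
      fix x y t assume xy: "x \<in> {x \<in> ?C. ?\<sigma> x = T}" "y \<in> {x \<in> ?C. ?\<sigma> x = T}" and t: "0 \<le> t" "t \<le> (1::real)"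
      then have sub: "T \<subseteq> H" by auto
      have "f h (\<lambda>i. (1 - t) * x i + t * y i) \<noteq> 0 \<and> (f h (\<lambda>i. (1 - t) * x i + t * y i) > 0 \<longleftrightarrow> h \<in> T)"
        if h: "h \<in> H" for h
        unfolding aff[OF h] by (rule same_side) (use xy h t in auto)
      moreover have "(\<lambda>i. (1 - t) * x i + t * y i) \<in> topspace ?E"
        using xy by (simp add: topspace_Euclidean_space)
      ultimately show "(\<lambda>i. (1 - t) * x i + t * y i) \<in> {x \<in> ?C. ?\<sigma> x = T}"
        unfolding fibre using sub by simp
    qed
    then show ?thesis unfolding top by (auto simp: connectedin_subtopology)
  qed
  have "regions n ((\<lambda>h. {x \<in> topspace ?E. f h x = 0}) ` H)
      = (\<lambda>T. {x \<in> topspace ?X. ?\<sigma> x = T}) ` ?\<sigma> ` topspace ?X"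
    unfolding regions_def compl by (rule connected_components_of_open_fibres[OF opn conn])
  moreover have "inj_on (\<lambda>T. {x \<in> topspace ?X. ?\<sigma> x = T}) (?\<sigma> ` topspace ?X)"
    by (rule inj_onI) blast
  ultimately show ?thesis
    unfolding num_regions_def top by (simp add: card_image)
qed

section \<open>Difference patterns\<close>

text \<open>
  The triple \<open>(i, j, k)\<close> stands for the form \<open>y i - y j - k\<close>. The index set is an arbitrary set of
  naturals because the two blocks of coordinates of the multiplicative arrangement need not be
  intervals.
\<close>
definition difference_forms :: "int set \<Rightarrow> nat set \<Rightarrow> (nat \<times> nat \<times> int) set" where
  "difference_forms S I = {(i, j, k). i \<in> I \<and> j \<in> I \<and> i < j \<and> k \<in> S}"

definition difference_generic :: "int set \<Rightarrow> nat set \<Rightarrow> (nat \<Rightarrow> real) set" where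
  "difference_generic S I = {y. \<forall>(i, j, k) \<in> difference_forms S I. y i - y j \<noteq> of_int k}"

definition difference_pattern :: "int set \<Rightarrow> nat set \<Rightarrow> (nat \<Rightarrow> real) \<Rightarrow> (nat \<times> nat \<times> int) set" where
  "difference_pattern S I y = {(i, j, k) \<in> difference_forms S I. y i - y j > of_int k}"

definition difference_patterns :: "int set \<Rightarrow> nat set \<Rightarrow> (nat \<times> nat \<times> int) set set" where
  "difference_patterns S I = difference_pattern S I ` difference_generic S I"

lemma finite_difference_forms: "finite S \<Longrightarrow> finite I \<Longrightarrow> finite (difference_forms S I)"
  by (rule finite_subset[of _ "I \<times> I \<times> S"]) (auto simp: difference_forms_def)

lemma finite_difference_patterns: "finite S \<Longrightarrow> finite I \<Longrightarrow> finite (difference_patterns S I)"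
  by (rule finite_subset[of _ "Pow (difference_forms S I)"])
    (auto simp: difference_patterns_def difference_pattern_def finite_difference_forms)

text \<open>
  The forms within \<open>P\<close> or within its complement are those whose two indices lie on the same side.
  This is what allows the pair of patterns on the two blocks to be compared with one pattern on \<open>I\<close>.
\<close>
lemma ball_difference_forms_split:
  assumes "P \<subseteq> I"
  shows "(\<forall>d\<in>difference_forms S P. Q d) \<and> (\<forall>d\<in>difference_forms S (I - P). Q d) \<longleftrightarrow>
    (\<forall>(i, j, k)\<in>difference_forms S I. (i \<in> P \<longleftrightarrow> j \<in> P) \<longrightarrow> Q (i, j, k))"
  using assms unfolding difference_forms_def by (auto; blast)

lemma difference_generic_cong:
  "(\<And>i. i \<in> I \<Longrightarrow> y i = z i) \<Longrightarrow> y \<in> difference_generic S I \<longleftrightarrow> z \<in> difference_generic S I"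
  by (auto simp: difference_generic_def difference_forms_def)

lemma difference_pattern_cong:
  "(\<And>i. i \<in> I \<Longrightarrow> y i = z i) \<Longrightarrow> difference_pattern S I y = difference_pattern S I z"
  by (auto simp: difference_pattern_def difference_forms_def)

lemma continuous_map_Euclidean_space_coordinate:
  "continuous_map (Euclidean_space n) euclideanreal (\<lambda>x. x i)"
  unfolding Euclidean_space_def
  by (intro continuous_map_from_subtopology continuous_map_product_projection) auto

text \<open>
  Points of the ambient space vanish beyond the coordinate \<open>n\<close>, whereas \<^const>\<open>difference_patterns\<close>
  lets those coordinates vary freely; truncating a point does not change its pattern.
\<close>
lemma num_regions_add_arrangement:
  assumes "finite S"
  shows "num_regions n (add_arrangement S n) = card (difference_patterns S {..<n})"
proof -
  let ?E = "Euclidean_space n" and ?H = "difference_forms S {..<n}"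
  let ?f = "\<lambda>(i, j, k) x. x i - x j - real_of_int k :: real"
  have arr: "add_arrangement S n = (\<lambda>h. {x \<in> topspace ?E. ?f h x = 0}) ` ?H"
    unfolding add_arrangement_def difference_forms_def by (force simp: image_iff)
  have "num_regions n (add_arrangement S n) =
      card ((\<lambda>x. {h \<in> ?H. ?f h x > 0}) ` {x \<in> topspace ?E. \<forall>h\<in>?H. ?f h x \<noteq> 0})"
    unfolding arr
    by (rule num_regions_eq_card_sign_patterns)
      (auto simp: finite_difference_forms assms algebra_simps
        intro!: continuous_map_add continuous_map_diff continuous_map_Euclidean_space_coordinate)
  also have "(\<lambda>x. {h \<in> ?H. ?f h x > 0}) = difference_pattern S {..<n}"
    by (auto simp: difference_pattern_def fun_eq_iff)
  also have "{x \<in> topspace ?E. \<forall>h\<in>?H. ?f h x \<noteq> 0} = topspace ?E \<inter> difference_generic S {..<n}"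
    by (auto simp: difference_generic_def)
  also have "difference_pattern S {..<n} ` (topspace ?E \<inter> difference_generic S {..<n}) =
      difference_patterns S {..<n}"
    unfolding difference_patterns_def
  proof (rule equalityI[OF image_mono[OF Int_lower2] image_subsetI])
    fix y assume y: "y \<in> difference_generic S {..<n}"
    let ?z = "\<lambda>i. if i < n then y i else 0"
    have "?z \<in> topspace ?E \<inter> difference_generic S {..<n}"
      using y difference_generic_cong[of "{..<n}" ?z y] by (auto simp: topspace_Euclidean_space)
    moreover have "difference_pattern S {..<n} y = difference_pattern S {..<n} ?z"
      by (rule difference_pattern_cong) auto
    ultimately show "difference_pattern S {..<n} y
        \<in> difference_pattern S {..<n} ` (topspace ?E \<inter> difference_generic S {..<n})"
      by blast
  qed
  finally show ?thesis .
qed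

text \<open>
  The increasing enumeration \<open>e\<close> of \<open>I\<close> respects the condition \<open>i < j\<close> in the index triples, so
  the pattern of \<open>y\<close> on \<open>I\<close> is that of \<open>y \<circ> e\<close> with its indices renamed by \<open>e\<close>, and renaming is
  injective.
\<close>
lemma card_difference_patterns:
  assumes "finite I"
  shows "card (difference_patterns S I) = card (difference_patterns S {..<card I})"
proof -
  define J where "J = {..<card I}"
  obtain e where e: "bij_betw e J I" and mono: "strict_mono_on J e"
    unfolding J_def using ex_bij_betw_strict_mono_card[OF assms] by blast
  let ?m = "\<lambda>(i, j, k). (e i, e j, k :: int)"
  have inj: "inj_on e J" and img: "e ` J = I" using e by (auto simp: bij_betw_def)
  have less: "e i < e j \<longleftrightarrow> i < j" if "i \<in> J" "j \<in> J" for i j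
    using strict_mono_on_less[OF mono that] .
  have forms: "difference_forms S I = ?m ` difference_forms S J"
    unfolding difference_forms_def img[symmetric] using less by (force simp: image_iff)
  have injm: "inj_on ?m (difference_forms S J)"
    using inj by (auto simp: difference_forms_def inj_on_def)
  have gen: "y \<in> difference_generic S I \<longleftrightarrow> y \<circ> e \<in> difference_generic S J" for y
    unfolding difference_generic_def forms by auto
  have pat: "difference_pattern S I y = ?m ` difference_pattern S J (y \<circ> e)" for y
    unfolding difference_pattern_def forms by (force simp: image_iff)
  have "difference_patterns S I = image ?m ` difference_patterns S J"
  proof (intro equalityI subsetI)
    fix p assume "p \<in> difference_patterns S I"
    then show "p \<in> image ?m ` difference_patterns S J"
      unfolding difference_patterns_def using gen pat by auto
  next
    fix p assume "p \<in> image ?m ` difference_patterns S J"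
    then obtain z where z: "z \<in> difference_generic S J" and p: "p = ?m ` difference_pattern S J z"
      by (auto simp: difference_patterns_def)
    let ?y = "z \<circ> inv_into J e"
    have eq: "(?y \<circ> e) i = z i" if "i \<in> J" for i using inj that by (simp add: inv_into_f_f)
    have "?y \<in> difference_generic S I"
      using z gen[of ?y] difference_generic_cong[of J "?y \<circ> e" z, OF eq] by blast
    moreover have "p = difference_pattern S I ?y"
      using p pat[of ?y] difference_pattern_cong[of J "?y \<circ> e" z, OF eq] by simp
    ultimately show "p \<in> difference_patterns S I" by (auto simp: difference_patterns_def)
  qed
  moreover have "inj_on (image ?m) (difference_patterns S J)"
    by (rule inj_on_subset[OF inj_on_image_Pow[OF injm]])
      (auto simp: difference_patterns_def difference_pattern_def)
  ultimately show ?thesis by (simp add: card_image J_def)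
qed

section \<open>Taking logarithms\<close>

lemma card_image_eq_if_same_kernel:
  assumes "\<And>x y. x \<in> A \<Longrightarrow> y \<in> A \<Longrightarrow> f x = f y \<longleftrightarrow> g x = g y"
  shows "card (f ` A) = card (g ` A)"
proof -
  have "bij_betw (\<lambda>u. g (inv_into A f u)) (f ` A) (g ` A)"
  proof (rule bij_betw_imageI)
    show "inj_on (\<lambda>u. g (inv_into A f u)) (f ` A)"
      by (rule inj_onI) (metis assms f_inv_into_f inv_into_into)
    have "g (inv_into A f (f x)) = g x" if "x \<in> A" for x
      using that assms by (metis f_inv_into_f image_eqI inv_into_into)
    then show "(\<lambda>u. g (inv_into A f u)) ` f ` A = g ` A"
      by (simp add: image_image)
  qed
  then show ?thesis by (rule bij_betw_same_card)
qed

lemma powi_compare_iff_log: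
  fixes a u v :: real
  assumes "a > 1" "u > 0" "v > 0"
  shows "a powi k * v < u \<longleftrightarrow> of_int k < log a u - log a v"
    and "u < a powi k * v \<longleftrightarrow> log a u - log a v < of_int k"
    and "u = a powi k * v \<longleftrightarrow> log a u - log a v = of_int k"
proof -
  have pos: "a powi k * v > 0" using assms by (simp add: zero_less_power_int)
  have "log a (a powi k * v) = log a (a powr of_int k) + log a v"
    using assms by (subst log_mult) (auto simp: powr_real_of_int' zero_less_power_int)
  then have lg: "log a (a powi k * v) = of_int k + log a v" using assms by simp
  show "a powi k * v < u \<longleftrightarrow> of_int k < log a u - log a v"
    using log_less_cancel_iff[of a "a powi k * v" u] lg pos assms by linarith
  show "u < a powi k * v \<longleftrightarrow> log a u - log a v < of_int k"
    using log_less_cancel_iff[of a u "a powi k * v"] lg pos assms by linarith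
  show "u = a powi k * v \<longleftrightarrow> log a u - log a v = of_int k"
    using log_less_cancel_iff[of a u "a powi k * v"] log_less_cancel_iff[of a "a powi k * v" u]
      lg pos assms by linarith
qed

text \<open>
  For opposite signs, \<open>u\<close> and \<open>- (a powi k) * v\<close> have the same sign, which decides the comparison.
  Two negative numbers are compared through their opposites, which reverses the inequality between
  the logarithms.
\<close>
lemma
  fixes a u v :: real
  assumes a: "a > 1" and u: "u \<noteq> 0" and v: "v \<noteq> 0"
  shows zero_iff_log_abs: "u - a powi k * v = 0 \<longleftrightarrow>
      (u > 0 \<longleftrightarrow> v > 0) \<and> log a \<bar>u\<bar> - log a \<bar>v\<bar> = of_int k"
    and pos_iff_log_abs: "u - a powi k * v > 0 \<longleftrightarrow>
      (if u > 0 then v > 0 \<longrightarrow> log a \<bar>u\<bar> - log a \<bar>v\<bar> > of_int k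
       else v < 0 \<and> log a \<bar>u\<bar> - log a \<bar>v\<bar> < of_int k)"
proof -
  have pos: "a powi k > 0" using a by (simp add: zero_less_power_int)
  consider "u > 0" "v > 0" | "u > 0" "v < 0" | "u < 0" "v > 0" | "u < 0" "v < 0"
    using u v by (metis linorder_neqE_linordered_idom)
  then have "(u - a powi k * v = 0 \<longleftrightarrow>
        (u > 0 \<longleftrightarrow> v > 0) \<and> log a \<bar>u\<bar> - log a \<bar>v\<bar> = of_int k) \<and>
      (u - a powi k * v > 0 \<longleftrightarrow>
        (if u > 0 then v > 0 \<longrightarrow> log a \<bar>u\<bar> - log a \<bar>v\<bar> > of_int k
         else v < 0 \<and> log a \<bar>u\<bar> - log a \<bar>v\<bar> < of_int k))"
  proof cases
    case 1
    then show ?thesis using powi_compare_iff_log[OF a, of u v k] by simp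
  next
    case 2
    then have "u - a powi k * v > 0" using mult_pos_neg[OF pos, of v] by linarith
    then show ?thesis using 2 by simp
  next
    case 3
    then have "u - a powi k * v < 0" using mult_pos_pos[OF pos, of v] by linarith
    then show ?thesis using 3 by simp
  next
    case 4
    then show ?thesis using powi_compare_iff_log[OF a, of "-u" "-v" k] by simp
  qed
  then show "u - a powi k * v = 0 \<longleftrightarrow>
      (u > 0 \<longleftrightarrow> v > 0) \<and> log a \<bar>u\<bar> - log a \<bar>v\<bar> = of_int k"
    and "u - a powi k * v > 0 \<longleftrightarrow>
      (if u > 0 then v > 0 \<longrightarrow> log a \<bar>u\<bar> - log a \<bar>v\<bar> > of_int k
       else v < 0 \<and> log a \<bar>u\<bar> - log a \<bar>v\<bar> < of_int k)"
    by simp_all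
qed

text \<open>
  The index set \<open>P\<close> records which coordinates are positive; the two patterns are those of
  \<open>log a \<bar>x i\<bar>\<close> on the positive and on the negative coordinates.

  On the negative coordinates the sign of \<open>x i - a powi k * x j\<close> is opposite to that of the
  logarithmic form. The patterns of the triple are therefore not parts of the sign pattern of \<open>x\<close>,
  but sign pattern and triple separate the same pairs of points, and this suffices to count them.
\<close>
lemma num_regions_mult_arrangement:
  assumes a: "a > 1" and S: "finite S"
  shows "num_regions n (mult_arrangement a S n) =
    card (SIGMA P : Pow {..<n}. difference_patterns S P \<times> difference_patterns S ({..<n} - P))"
proof -
  let ?E = "Euclidean_space n" and ?D = "difference_forms S {..<n}"
  let ?H = "{..<n} <+> ?D"
  let ?f = "case_sum (\<lambda>i x. x i) (\<lambda>(i, j, k) x. x i - a powi k * x j :: real)"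
  let ?C = "{x \<in> topspace ?E. \<forall>h\<in>?H. ?f h x \<noteq> 0}"
  let ?\<sigma> = "\<lambda>x. {h \<in> ?H. ?f h x > 0}"
  let ?P = "\<lambda>x :: nat \<Rightarrow> real. {i. i < n \<and> x i > 0}"
  let ?l = "\<lambda>(x :: nat \<Rightarrow> real) i. log a \<bar>x i\<bar>"
  let ?g = "\<lambda>x. (?P x, difference_pattern S (?P x) (?l x), difference_pattern S ({..<n} - ?P x) (?l x))"
  have arr: "mult_arrangement a S n = (\<lambda>h. {x \<in> topspace ?E. ?f h x = 0}) ` ?H"
    unfolding mult_arrangement_def difference_forms_def Plus_def image_Un image_image
    by (intro arg_cong2[of _ _ _ _ "(\<union>)"]) (force simp: image_iff)+
  have ball_H: "(\<forall>h\<in>?H. Q h) \<longleftrightarrow> (\<forall>i<n. Q (Inl i)) \<and> (\<forall>d\<in>?D. Q (Inr d))" for Q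
    by (auto simp: Plus_def)
  have C_iff: "x \<in> ?C \<longleftrightarrow> x \<in> topspace ?E \<and> (\<forall>i<n. x i \<noteq> 0) \<and>
      ?l x \<in> difference_generic S (?P x) \<and> ?l x \<in> difference_generic S ({..<n} - ?P x)" for x
  proof -
    have "(\<forall>(i, j, k)\<in>?D. x i - a powi k * x j \<noteq> 0) \<longleftrightarrow>
        ?l x \<in> difference_generic S (?P x) \<and> ?l x \<in> difference_generic S ({..<n} - ?P x)"
      if nz: "\<forall>i<n. x i \<noteq> 0"
    proof -
      have "?l x \<in> difference_generic S (?P x) \<and> ?l x \<in> difference_generic S ({..<n} - ?P x) \<longleftrightarrow>
          (\<forall>(i, j, k)\<in>?D. (i \<in> ?P x \<longleftrightarrow> j \<in> ?P x) \<longrightarrow> ?l x i - ?l x j \<noteq> of_int k)"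
        unfolding difference_generic_def mem_Collect_eq by (subst ball_difference_forms_split) auto
      also have "\<dots> \<longleftrightarrow> (\<forall>(i, j, k)\<in>?D. x i - a powi k * x j \<noteq> 0)"
      proof (rule ball_cong[OF refl])
        fix d assume "d \<in> ?D"
        then obtain i j k where d: "d = (i, j, k)" and ij: "i < n" "j < n"
          by (auto simp: difference_forms_def)
        show "(case d of (i, j, k) \<Rightarrow> (i \<in> ?P x \<longleftrightarrow> j \<in> ?P x) \<longrightarrow> ?l x i - ?l x j \<noteq> of_int k) \<longleftrightarrow>
            (case d of (i, j, k) \<Rightarrow> x i - a powi k * x j \<noteq> 0)"
          unfolding d prod.case using ij zero_iff_log_abs[OF a, of "x i" "x j" k] nz by (simp; blast)
      qed
      finally show ?thesis by (rule sym)
    qed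
    then show ?thesis unfolding mem_Collect_eq ball_H by (auto split: prod.splits)
  qed
  have same: "?\<sigma> x = ?\<sigma> y \<longleftrightarrow> ?g x = ?g y" if x: "x \<in> ?C" and y: "y \<in> ?C" for x y
  proof -
    have \<sigma>_eq: "?\<sigma> x = ?\<sigma> y \<longleftrightarrow> (\<forall>h\<in>?H. ?f h x > 0 \<longleftrightarrow> ?f h y > 0)" by blast
    have P_eq: "?P x = ?P y \<longleftrightarrow> (\<forall>i<n. x i > 0 \<longleftrightarrow> y i > 0)" by blast
    have nz: "\<forall>i<n. x i \<noteq> 0" "\<forall>i<n. y i \<noteq> 0"
      using x y C_iff by blast+
    have pat_eq: "difference_pattern S I u = difference_pattern S I v \<longleftrightarrow>
        (\<forall>(i, j, k)\<in>difference_forms S I. u i - u j > of_int k \<longleftrightarrow> v i - v j > of_int k)" for I u v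
      unfolding difference_pattern_def by (auto simp: set_eq_iff)
    have pair: "(x i - a powi k * x j > 0 \<longleftrightarrow> y i - a powi k * y j > 0) \<longleftrightarrow>
        ((x i > 0 \<longleftrightarrow> x j > 0) \<longrightarrow> (?l x i - ?l x j > of_int k \<longleftrightarrow> ?l y i - ?l y j > of_int k))"
      if P: "?P x = ?P y" and d: "(i, j, k) \<in> ?D" for i j k
    proof -
      have ij: "i < n" "j < n" using d by (auto simp: difference_forms_def)
      then have nz': "x i \<noteq> 0" "x j \<noteq> 0" "y i \<noteq> 0" "y j \<noteq> 0" using nz by auto
      \<comment> \<open>Off the hyperplanes \<open><\<close> is the negation of \<open>>\<close>, which absorbs the reversal of the
        inequality on the negative coordinates.\<close>
      have "x i - a powi k * x j \<noteq> 0" "y i - a powi k * y j \<noteq> 0"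
        using x y d by (auto simp: ball_H)
      then show ?thesis
        using P[unfolded P_eq, rule_format, OF ij(1)] P[unfolded P_eq, rule_format, OF ij(2)] nz'
        unfolding zero_iff_log_abs[OF a nz'(1,2)] zero_iff_log_abs[OF a nz'(3,4)]
          pos_iff_log_abs[OF a nz'(1,2)] pos_iff_log_abs[OF a nz'(3,4)]
        by (smt (verit))
    qed
    have "(\<forall>(i, j, k)\<in>?D. x i - a powi k * x j > 0 \<longleftrightarrow> y i - a powi k * y j > 0) \<longleftrightarrow>
       difference_pattern S (?P x) (?l x) = difference_pattern S (?P x) (?l y) \<and>
       difference_pattern S ({..<n} - ?P x) (?l x) = difference_pattern S ({..<n} - ?P x) (?l y)"
      if P: "?P x = ?P y"
    proof -
      have "(\<forall>(i, j, k)\<in>?D. x i - a powi k * x j > 0 \<longleftrightarrow> y i - a powi k * y j > 0) \<longleftrightarrow>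
        (\<forall>(i, j, k)\<in>?D. (x i > 0 \<longleftrightarrow> x j > 0) \<longrightarrow>
            (?l x i - ?l x j > of_int k \<longleftrightarrow> ?l y i - ?l y j > of_int k))"
        using pair[OF P] by (intro ball_cong refl) auto
      also have "\<dots> \<longleftrightarrow> difference_pattern S (?P x) (?l x) = difference_pattern S (?P x) (?l y) \<and>
         difference_pattern S ({..<n} - ?P x) (?l x) = difference_pattern S ({..<n} - ?P x) (?l y)"
        unfolding pat_eq by (subst ball_difference_forms_split) (auto simp: difference_forms_def)
      finally show ?thesis .
    qed
    moreover have "?\<sigma> x = ?\<sigma> y \<longleftrightarrow> ?P x = ?P y \<and>
        (\<forall>(i, j, k)\<in>?D. x i - a powi k * x j > 0 \<longleftrightarrow> y i - a powi k * y j > 0)"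
      unfolding \<sigma>_eq ball_H P_eq by (simp add: case_prod_unfold)
    ultimately show ?thesis
      by (cases "?P x = ?P y") (simp_all only: prod.inject simp_thms)
  qed
  have range: "?g ` ?C = (SIGMA P : Pow {..<n}. difference_patterns S P \<times> difference_patterns S ({..<n} - P))"
  proof (intro equalityI subsetI)
    fix p assume "p \<in> ?g ` ?C"
    then show "p \<in> (SIGMA P : Pow {..<n}. difference_patterns S P \<times> difference_patterns S ({..<n} - P))"
      unfolding difference_patterns_def image_iff Bex_def C_iff by auto
  next
    fix p assume "p \<in> (SIGMA P : Pow {..<n}. difference_patterns S P \<times> difference_patterns S ({..<n} - P))"
    then obtain P u v where p: "p = (P, difference_pattern S P u, difference_pattern S ({..<n} - P) v)"
      and P: "P \<subseteq> {..<n}" and u: "u \<in> difference_generic S P"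
      and v: "v \<in> difference_generic S ({..<n} - P)"
      by (auto simp: difference_patterns_def)
    \<comment> \<open>Exponentials of \<open>u\<close> on the positive block and of \<open>v\<close> on the negative block; the value \<open>0\<close>
      beyond \<open>n\<close> keeps the point in the ambient space.\<close>
    let ?x = "\<lambda>i. if i \<in> P then a powr u i else if i < n then - (a powr v i) else 0"
    have Px: "?P ?x = P" using P a by (auto simp: not_less)
    have lu: "?l ?x i = u i" if "i \<in> P" for i using that a by simp
    have lv: "?l ?x i = v i" if "i \<in> {..<n} - P" for i using that a by simp
    have "?l ?x \<in> difference_generic S P" "?l ?x \<in> difference_generic S ({..<n} - P)"
      using u difference_generic_cong[of P "?l ?x" u S, OF lu]
        v difference_generic_cong[of "{..<n} - P" "?l ?x" v S, OF lv] by blast+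
    then have "?x \<in> ?C"
      unfolding C_iff Px using P a by (auto simp: topspace_Euclidean_space)
    moreover have "p = ?g ?x"
      unfolding p Px using difference_pattern_cong[of P "?l ?x" u S, OF lu]
        difference_pattern_cong[of "{..<n} - P" "?l ?x" v S, OF lv] by simp
    ultimately show "p \<in> ?g ` ?C" by (rule rev_image_eqI[of ?x ?C p ?g])
  qed
  have "num_regions n (mult_arrangement a S n) = card (?\<sigma> ` ?C)"
    unfolding arr
    by (rule num_regions_eq_card_sign_patterns)
      (auto simp: finite_difference_forms S algebra_simps
        intro!: continuous_map_diff continuous_map_real_mult_right continuous_map_Euclidean_space_coordinate)
  also have "\<dots> = card (?g ` ?C)"
    by (rule card_image_eq_if_same_kernel[OF same])
  finally show ?thesis unfolding range .
qed

theorem theorem3p23: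
  fixes a :: real and S :: "int set" and n :: nat
  assumes "a > 1" and "finite S"
  shows "num_regions n (mult_arrangement a S n) =
    (\<Sum>k=0..n. (n choose k) * num_regions k (add_arrangement S k)
                             * num_regions (n - k) (add_arrangement S (n - k)))"
proof -
  let ?r = "\<lambda>k. num_regions k (add_arrangement S k)"
  have r: "card (difference_patterns S I) = ?r (card I)" if "finite I" for I
    using card_difference_patterns[OF that, of S] by (simp add: num_regions_add_arrangement assms)
  have "num_regions n (mult_arrangement a S n) =
      (\<Sum>P\<in>Pow {..<n}. card (difference_patterns S P \<times> difference_patterns S ({..<n} - P)))"
    unfolding num_regions_mult_arrangement[OF assms]
    by (rule card_SigmaI)
      (auto intro!: finite_cartesian_product finite_difference_patterns assms intro: finite_subset)
  also have "\<dots> = (\<Sum>P\<in>Pow {..<n}. ?r (card P) * ?r (n - card P))"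
  proof (rule sum.cong[OF refl])
    fix P assume "P \<in> Pow {..<n}"
    then have "P \<subseteq> {..<n}" "finite P" by (auto intro: finite_subset)
    then show "card (difference_patterns S P \<times> difference_patterns S ({..<n} - P)) =
        ?r (card P) * ?r (n - card P)"
      by (simp add: card_cartesian_product r card_Diff_subset)
  qed
  also have "\<dots> = (\<Sum>k=0..n. \<Sum>P\<in>{P \<in> Pow {..<n}. card P = k}. ?r (card P) * ?r (n - card P))"
    by (rule sum.group[symmetric]) (auto dest: card_mono[of "{..<n}", rotated])
  also have "\<dots> = (\<Sum>k=0..n. (n choose k) * ?r k * ?r (n - k))"
    using n_subsets[of "{..<n}"] by (intro sum.cong[OF refl]) simp
  finally show ?thesis .
qed

end
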